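(* Let $$A = \begin{bmatrix} I & A_{pn} \\ A_{pn}^\top & A_{nn} \end{bmatrix}$$ be a real symmetric positive-definite matrix, partitioned into blocks indexed by $p$ and $n$, whose $p$–$p$ block is the identity. For any decomposition $$A_{pn} = Q_{pf} W_{fn} + Q_{pc} W_{cn}$$ in which $Q_p = \begin{bmatrix} Q_{pf} & Q_{pc} \end{bmatrix}$ is a square orthogonal matrix, the matrix $$B_p = \begin{bmatrix} I & W_{cn} \\ W_{cn}^\top & A_{nn} \end{bmatrix}$$ is symmetric positive-definite.
   Context: The letters $p, n, f, c$ denote index sets, and a matrix $M_{ab}$ has rows indexed by $a$ and columns indexed by $b$; $|f| + |c| = |p|$. Here $Q_p$ is a $|p| \times |p|$ real orthogonal matrix whose columns are split into $Q_{pf}$ ($|p|\times|f|$) and $Q_{pc}$ ($|p| \times |c|$), $W_{fn}$ is $|f|\times|n|$ and $W_{cn}$ is $|c|\times|n|$. The identity block in $B_p$ has size $|c|\times|c|$. The decomposition is thought of as a low-rank approximation $A_{pn} \approx Q_{pc}W_{cn}$ with discarded part $Q_{pf} W_{fn}$, but no smallness of $W_{fn}$ is assumed. *)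

theory Defs
  imports "Jordan_Normal_Form.Matrix" Complex_Main
begin

definition sym_pos_def :: "real mat \<Rightarrow> bool" where
  "sym_pos_def M \<longleftrightarrow> square_mat M \<and> transpose_mat M = M \<and>
     (\<forall>x \<in> carrier_vec (dim_row M). x \<noteq> 0\<^sub>v (dim_row M) \<longrightarrow> 0 < x \<bullet> (M *\<^sub>v x))"

(* The library's orthogonal_mat only asks for pairwise orthogonal nonzero columns;
   here the columns have to be orthonormal. *)
definition real_orthogonal_mat :: "real mat \<Rightarrow> bool" where
  "real_orthogonal_mat Q \<longleftrightarrow> square_mat Q \<and>
     inverts_mat (transpose_mat Q) Q \<and> inverts_mat Q (transpose_mat Q)"

(* The block matrix [A B], as a four-block matrix whose lower blocks have no rows;
   meaningful when A and B have the same number of rows. *)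
definition append_cols :: "'a::zero mat \<Rightarrow> 'a mat \<Rightarrow> 'a mat" (infixr \<open>@\<^sub>c\<close> 65) where
  "A @\<^sub>c B = four_block_mat A B (0\<^sub>m 0 (dim_col A)) (0\<^sub>m 0 (dim_col B))"

end

theory Submission
  imports Defs
begin

text \<open>
  For \<open>z = (y, x)\<close> put \<open>w = W\<^sub>f\<^sub>n x\<close> and \<open>u = Q\<^sub>p\<^sub>c y - Q\<^sub>p\<^sub>f w\<close>.  Orthogonality of \<open>Q\<^sub>p\<close> turns the quadratic
  form of \<open>A\<close> at \<open>(u, x)\<close> into \<open>z\<^sup>T B\<^sub>p z - w\<^sup>T w\<close>.  Since \<open>u\<^sup>T u = w\<^sup>T w + y\<^sup>T y\<close>, the vector
  \<open>(u, x)\<close> vanishes only if \<open>z\<close> does, so \<open>B\<^sub>p\<close> inherits positivity from \<open>A\<close>.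
\<close>

lemma real_scalar_prod_self_ge_0: "0 \<le> v \<bullet> (v :: real vec)"
  by (auto simp: scalar_prod_def intro: sum_nonneg)

text \<open>Conjugation is the identity on the reals, so definiteness of the conjugated scalar
  product applies.\<close>

lemma real_scalar_prod_self_eq_0:
  fixes v :: "real vec"
  assumes "v \<in> carrier_vec n" "v \<bullet> v = 0"
  shows "v = 0\<^sub>v n"
  using conjugate_square_eq_0_vec[OF assms(1)] assms(2) by simp

lemma real_orthogonal_mat_scalar_prod:
  assumes "real_orthogonal_mat Q" and Q: "Q \<in> carrier_mat n n"
    and u: "u \<in> carrier_vec n" and v: "v \<in> carrier_vec n"
  shows "(Q *\<^sub>v u) \<bullet> (Q *\<^sub>v v) = u \<bullet> v"
proof -
  have inv: "transpose_mat Q * Q = 1\<^sub>m n"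
    using assms(1) Q by (auto simp: real_orthogonal_mat_def inverts_mat_def)
  have "(Q *\<^sub>v u) \<bullet> (Q *\<^sub>v v) = (transpose_mat Q *\<^sub>v (Q *\<^sub>v u)) \<bullet> v"
    using transpose_vec_mult_scalar[OF Q v, of "Q *\<^sub>v u"] Q u by simp
  also have "transpose_mat Q *\<^sub>v (Q *\<^sub>v u) = (transpose_mat Q * Q) *\<^sub>v u"
    using Q u by (intro assoc_mult_mat_vec[symmetric]) auto
  finally show ?thesis using inv u by simp
qed

text \<open>The lower blocks have no rows, so they only append an empty vector to the
  product.\<close>

lemma append_cols_mult_vec:
  assumes A: "A \<in> carrier_mat m k" and B: "B \<in> carrier_mat m l"
    and a: "a \<in> carrier_vec k" and b: "b \<in> carrier_vec l"
  shows "(A @\<^sub>c B) *\<^sub>v (a @\<^sub>v b) = A *\<^sub>v a + B *\<^sub>v b"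
proof -
  have dims: "dim_col A = k" "dim_col B = l" using A B by auto
  have "(A @\<^sub>c B) *\<^sub>v (a @\<^sub>v b)
      = (A *\<^sub>v a + B *\<^sub>v b) @\<^sub>v (0\<^sub>m 0 k *\<^sub>v a + 0\<^sub>m 0 l *\<^sub>v b)"
    unfolding append_cols_def dims
    by (rule four_block_mat_mult_vec[OF A B _ _ a b]) auto
  also have "\<dots> = A *\<^sub>v a + B *\<^sub>v b"
    by (rule eq_vecI) auto
  finally show ?thesis .
qed

text \<open>Orthonormality within each block and orthogonality between the blocks in one identity:
  scalar products can be read off from coordinates with respect to the columns of \<open>A\<close>
  and \<open>B\<close>.\<close>

lemma orthogonal_append_cols_scalar_prod:
  assumes orth: "real_orthogonal_mat (A @\<^sub>c B)"
    and A: "A \<in> carrier_mat (k + l) k" and B: "B \<in> carrier_mat (k + l) l"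
    and a: "a \<in> carrier_vec k" "a' \<in> carrier_vec k"
    and b: "b \<in> carrier_vec l" "b' \<in> carrier_vec l"
  shows "(A *\<^sub>v a + B *\<^sub>v b) \<bullet> (A *\<^sub>v a' + B *\<^sub>v b') = a \<bullet> a' + b \<bullet> b'"
proof -
  have "A @\<^sub>c B \<in> carrier_mat (k + l) (k + l)"
    using A B by (auto simp: append_cols_def)
  from real_orthogonal_mat_scalar_prod[OF orth this, of "a @\<^sub>v b" "a' @\<^sub>v b'"]
  show ?thesis
    using a b by (simp add: append_cols_mult_vec[OF A B] scalar_prod_append[OF a(1) b(1) a(2) b(2)])
qed

text \<open>Carries symmetry from \<open>A\<close> to \<open>B_p\<close>: one direction extracts it
  for the shared block \<open>A_nn\<close>, the other puts it back around
  \<open>W_cn\<close>.\<close>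

lemma symmetric_four_block_one_iff:
  fixes N :: "'a :: {zero, one} mat"
  assumes M: "M \<in> carrier_mat k n" and N: "N \<in> carrier_mat n n"
  shows "transpose_mat (four_block_mat (1\<^sub>m k) M (transpose_mat M) N)
           = four_block_mat (1\<^sub>m k) M (transpose_mat M) N \<longleftrightarrow> transpose_mat N = N"
    (is "transpose_mat ?F = ?F \<longleftrightarrow> _")
proof
  assume sym: "transpose_mat ?F = ?F"
  show "transpose_mat N = N"
  proof (rule eq_matI)
    fix i j assume ij: "i < dim_row N" "j < dim_col N"
    have "transpose_mat ?F $$ (k + i, k + j) = ?F $$ (k + i, k + j)" by (simp only: sym)
    then show "transpose_mat N $$ (i, j) = N $$ (i, j)" using ij M N by simp
  qed (use N in auto)
next
  assume "transpose_mat N = N"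
  then show "transpose_mat ?F = ?F"
    using transpose_four_block_mat[of "1\<^sub>m k" k k M n "transpose_mat M" n N] M N by simp
qed

text \<open>The two off-diagonal terms agree by moving the transpose across the scalar product.
  Applied with \<open>M\<close> as \<open>A_pn\<close> and as \<open>W_cn\<close>.\<close>

lemma four_block_one_quadratic_form:
  fixes M N :: "real mat"
  assumes M: "M \<in> carrier_mat k n" and N: "N \<in> carrier_mat n n"
    and y: "y \<in> carrier_vec k" and x: "x \<in> carrier_vec n"
  shows "(y @\<^sub>v x) \<bullet> (four_block_mat (1\<^sub>m k) M (transpose_mat M) N *\<^sub>v (y @\<^sub>v x))
           = y \<bullet> y + 2 * (y \<bullet> (M *\<^sub>v x)) + x \<bullet> (N *\<^sub>v x)"
proof -
  have Mx: "M *\<^sub>v x \<in> carrier_vec k" and Nx: "N *\<^sub>v x \<in> carrier_vec n"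
    and My: "transpose_mat M *\<^sub>v y \<in> carrier_vec n"
    using M N x y by auto
  have "four_block_mat (1\<^sub>m k) M (transpose_mat M) N *\<^sub>v (y @\<^sub>v x)
      = (y + M *\<^sub>v x) @\<^sub>v (transpose_mat M *\<^sub>v y + N *\<^sub>v x)"
    using four_block_mat_mult_vec[of "1\<^sub>m k" k k M n "transpose_mat M" n N y x] M N y x by simp
  moreover have "x \<bullet> (transpose_mat M *\<^sub>v y) = y \<bullet> (M *\<^sub>v x)"
    using transpose_vec_mult_scalar[OF M x y] comm_scalar_prod[OF x My] by simp
  ultimately show ?thesis
    using scalar_prod_append[OF y x, of "y + M *\<^sub>v x" "transpose_mat M *\<^sub>v y + N *\<^sub>v x"]
      scalar_prod_add_distrib[OF y y Mx] scalar_prod_add_distrib[OF x My Nx] Mx Nx My y x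
    by simp
qed

theorem theorem3p1:
  fixes p n f c :: nat
    and A A_pn A_nn Q_pf Q_pc W_fn W_cn :: "real mat"
  assumes "f + c = p"
    and "A_pn \<in> carrier_mat p n"
    and "A_nn \<in> carrier_mat n n"
    and "Q_pf \<in> carrier_mat p f"
    and "Q_pc \<in> carrier_mat p c"
    and "W_fn \<in> carrier_mat f n"
    and "W_cn \<in> carrier_mat c n"
    and "A = four_block_mat (1\<^sub>m p) A_pn (transpose_mat A_pn) A_nn"
    and "sym_pos_def A"
    and "real_orthogonal_mat (Q_pf @\<^sub>c Q_pc)"
    and "A_pn = Q_pf * W_fn + Q_pc * W_cn"
  shows "sym_pos_def (four_block_mat (1\<^sub>m c) W_cn (transpose_mat W_cn) A_nn)"
    (is "sym_pos_def ?B")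
proof -
  note [simp] = assms(2-7)[THEN carrier_matD(1)] assms(2-7)[THEN carrier_matD(2)] assms(2-7)
  have A_pos: "0 < v \<bullet> (A *\<^sub>v v)" if "v \<in> carrier_vec (p + n)" "v \<noteq> 0\<^sub>v (p + n)" for v
    using assms(3,8,9) that by (simp add: sym_pos_def_def)
  have "transpose_mat A_nn = A_nn"
    using assms(8,9) symmetric_four_block_one_iff[OF assms(2,3)] by (simp add: sym_pos_def_def)
  then have B_sym: "transpose_mat ?B = ?B"
    by (simp add: symmetric_four_block_one_iff[OF assms(7,3)])
  have B_pos: "0 < z \<bullet> (?B *\<^sub>v z)" if z: "z \<in> carrier_vec (c + n)" "z \<noteq> 0\<^sub>v (c + n)" for z
  proof -
    define y where "y = vec_first z c"
    define x where "x = vec_last z n"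
    define w where "w = W_fn *\<^sub>v x"
    \<comment> \<open>In the form of \<open>A\<close> at \<open>(Q_pf a + Q_pc y, x)\<close>, the
      terms containing \<open>a\<close> are |a|^2 + 2 a.w = |a + w|^2 - |w|^2, which is least at a =
      -w.\<close>
    define u where "u = Q_pf *\<^sub>v (- w) + Q_pc *\<^sub>v y"
    have z_eq: "z = y @\<^sub>v x" using z(1) by (simp add: y_def x_def)
    have y: "y \<in> carrier_vec c" and x: "x \<in> carrier_vec n" by (auto simp: y_def x_def)
    have w: "w \<in> carrier_vec f" and Wx: "W_cn *\<^sub>v x \<in> carrier_vec c"
      using x by (auto simp: w_def intro!: mult_mat_vec_carrier[OF assms(6)] mult_mat_vec_carrier[OF assms(7)])
    have u: "u \<in> carrier_vec p"
      using w y unfolding u_def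
      by (intro add_carrier_vec mult_mat_vec_carrier[OF assms(4)] mult_mat_vec_carrier[OF assms(5)]) auto
    \<comment> \<open>This expresses \<open>A_pn x\<close> in the same columns as \<open>u\<close>,
      ready for \<open>orth\<close>.\<close>
    have A_pn_x: "A_pn *\<^sub>v x = Q_pf *\<^sub>v w + Q_pc *\<^sub>v (W_cn *\<^sub>v x)"
      unfolding assms(11) w_def
      using add_mult_distrib_mat_vec[of "Q_pf * W_fn" p n "Q_pc * W_cn" x] x
        assoc_mult_mat_vec[OF assms(4,6) x] assoc_mult_mat_vec[OF assms(5,7) x]
        mult_carrier_mat[OF assms(4,6)] mult_carrier_mat[OF assms(5,7)]
      by simp
    note orth = orthogonal_append_cols_scalar_prod
      [OF assms(10) assms(4)[folded assms(1)] assms(5)[folded assms(1)]]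
    have uu: "u \<bullet> u = w \<bullet> w + y \<bullet> y"
      unfolding u_def using w y by (subst orth) auto
    have uAx: "u \<bullet> (A_pn *\<^sub>v x) = - (w \<bullet> w) + y \<bullet> (W_cn *\<^sub>v x)"
      unfolding u_def A_pn_x using w y Wx by (subst orth) auto
    \<comment> \<open>The term \<open>u \<bullet> u\<close> contributes |w|^2 and the doubled cross
      term -2 |w|^2.\<close>
    have "(u @\<^sub>v x) \<bullet> (A *\<^sub>v (u @\<^sub>v x)) = z \<bullet> (?B *\<^sub>v z) - w \<bullet> w"
      unfolding assms(8) z_eq four_block_one_quadratic_form[OF assms(2,3) u x]
        four_block_one_quadratic_form[OF assms(7,3) y x] uu uAx
      by simp
    moreover have "u @\<^sub>v x \<noteq> 0\<^sub>v (p + n)"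
    proof
      assume "u @\<^sub>v x = 0\<^sub>v (p + n)"
      \<comment> \<open>Splitting is wanted twice: with \<open>k = p\<close> to separate
        \<open>u\<close> from \<open>x\<close>, and with \<open>k = c\<close> to contradict
        \<open>z\<close> being nonzero.\<close>
      moreover have zero: "0\<^sub>v (k + n) = 0\<^sub>v k @\<^sub>v 0\<^sub>v n" for k by auto
      ultimately have "u = 0\<^sub>v p" and x0: "x = 0\<^sub>v n"
        using append_vec_eq[OF u, of "0\<^sub>v p" x "0\<^sub>v n"] by auto
      then have "w \<bullet> w + y \<bullet> y = 0" using uu by simp
      then have "y \<bullet> y = 0"
        using real_scalar_prod_self_ge_0[of w] real_scalar_prod_self_ge_0[of y] by linarith
      then have "y = 0\<^sub>v c" by (rule real_scalar_prod_self_eq_0[OF y])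
      with z(2) x0 z_eq show False by (simp add: zero)
    qed
    \<comment> \<open>The form of \<open>B_p\<close> at \<open>z\<close> exceeds |w|^2, hence
      0.\<close>
    ultimately show ?thesis
      using A_pos[of "u @\<^sub>v x"] u x real_scalar_prod_self_ge_0[of w] by simp
  qed
  show ?thesis using B_sym B_pos by (simp add: sym_pos_def_def)
qed

end
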